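(* Let $G$ be a signed graph on $n$ nodes in which every node has the same negative degree $d^-$ and all nodes have the same marking (all positively marked or all negatively marked). Let $\eta_1,\dots,\eta_n$ be the signed Laplacian eigenvalues of $G$, with $\eta_n=2d^-$. Define the two-valued function $f(x)=\frac{2d^-+1+x+n\pm\sqrt{[(2d^-+1)-(x+n)]^2+4n}}{2}$ and let $f^i$ denote the $i$-fold composition of $f$ with itself (so $f^i(x)$ consists of the $2^i$ values obtained by choosing a sign at each of the $i$ applications). Then the signed Laplacian eigenvalues of the signed corona graph $G^{(m)}$, $m\ge1$, generated by the seed graph $G$ are: (a) $f^m(\eta_j)$ with multiplicity $1$, $j=1,\dots,n$; (b) for $m>1$, $f^i(\eta_j+1)$ with multiplicity $n(n+1)^{m-i-1}$, $1\le i\le m-1$, $j=1,\dots,n-1$; (c) $\eta_j+1$ with multiplicity $n(n+1)^{m-1}$, $j=1,\dots,n-1$.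
   Context: A signed graph has edges signed $+$ or $-$; $d^\pm(v)$ are the numbers of positive/negative edges at $v$. Adjacency matrix $A$: entry $1$ for a positive edge, $-1$ for a negative edge, $0$ otherwise; signed Laplacian $L=D-A$ with $D$ diagonal of total degrees $d^++d^-$. Nodes carry a marking $\mu(v)\in\{+,-\}$; the standing convention is the canonical marking $\mu(v)=\prod_{e\ni v}\sigma(e)$ (product of signs of edges at $v$). Corona product of signed graphs $H_1$ (nodes $u_1,\dots,u_N$) and $H_2$: take one copy of $H_1$ and $N$ copies of $H_2$ and join $u_i$ to every node of the $i$-th copy of $H_2$, the edge from $u_i$ to the copy of $w$ having sign $\mu_{H_1}(u_i)\mu_{H_2}(w)$. Signed corona graphs generated by the seed graph $G$: $G^{(0)}=G$ and $G^{(m)}=G^{(m-1)}\circ G$ for $m\ge1$, each factor carrying its canonical marking. *)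

theory Defs
  imports "Jordan_Normal_Form.Char_Poly" "HOL-Library.Multiset"
begin

text \<open>Finite simple graphs on the nodes \<open>0, \<dots>, num_nodes - 1\<close> with signed edges; an edge is
  the set of its two end points.\<close>

record sgraph =
  num_nodes :: nat
  pos_edges :: "nat set set"
  neg_edges :: "nat set set"

definition edges :: "sgraph \<Rightarrow> nat set set" where
  "edges G = pos_edges G \<union> neg_edges G"

definition signed_graph :: "sgraph \<Rightarrow> bool" where
  "signed_graph G \<longleftrightarrow>
     (\<forall>e \<in> edges G. e \<subseteq> {..<num_nodes G} \<and> card e = 2) \<and>
     pos_edges G \<inter> neg_edges G = {}"

definition edge_sign :: "sgraph \<Rightarrow> nat set \<Rightarrow> int" where
  "edge_sign G e = (if e \<in> pos_edges G then 1 else -1)"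

definition pos_degree :: "sgraph \<Rightarrow> nat \<Rightarrow> nat" where
  "pos_degree G v = card {e \<in> pos_edges G. v \<in> e}"

definition neg_degree :: "sgraph \<Rightarrow> nat \<Rightarrow> nat" where
  "neg_degree G v = card {e \<in> neg_edges G. v \<in> e}"

definition marking :: "sgraph \<Rightarrow> nat \<Rightarrow> int" where
  "marking G v = (\<Prod>e \<in> {e \<in> edges G. v \<in> e}. edge_sign G e)"

definition adjacency_matrix :: "sgraph \<Rightarrow> real mat" where
  "adjacency_matrix G = mat (num_nodes G) (num_nodes G)
     (\<lambda>(i, j). if {i, j} \<in> edges G then of_int (edge_sign G {i, j}) else 0)"

definition degree_matrix :: "sgraph \<Rightarrow> real mat" where
  "degree_matrix G = mat (num_nodes G) (num_nodes G)
     (\<lambda>(i, j). if i = j then real (pos_degree G i + neg_degree G i) else 0)"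

definition signed_laplacian :: "sgraph \<Rightarrow> real mat" where
  "signed_laplacian G = degree_matrix G - adjacency_matrix G"

text \<open>The matrix is real symmetric, so the real roots of its characteristic polynomial are all
  its eigenvalues, and their algebraic and geometric multiplicities agree.\<close>

definition laplacian_eigenvalues :: "sgraph \<Rightarrow> real multiset" where
  "laplacian_eigenvalues G = proots (char_poly (signed_laplacian G))"

text \<open>In the corona of \<open>H1\<close> and \<open>H2\<close>, the nodes of \<open>H1\<close> keep their labels, and the nodes of the
  \<open>i\<close>-th copy of \<open>H2\<close> occupy the \<open>i\<close>-th block of \<open>num_nodes H2\<close> labels after them.\<close>

definition copy_node :: "sgraph \<Rightarrow> sgraph \<Rightarrow> nat \<Rightarrow> nat \<Rightarrow> nat" where
  "copy_node H1 H2 i w = num_nodes H1 + i * num_nodes H2 + w"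

definition corona :: "sgraph \<Rightarrow> sgraph \<Rightarrow> sgraph" where
  "corona H1 H2 = \<lparr>
     num_nodes = num_nodes H1 + num_nodes H1 * num_nodes H2,
     pos_edges = pos_edges H1
       \<union> {copy_node H1 H2 i ` e | i e. i < num_nodes H1 \<and> e \<in> pos_edges H2}
       \<union> {{i, copy_node H1 H2 i w} | i w. i < num_nodes H1 \<and> w < num_nodes H2 \<and>
            marking H1 i * marking H2 w = 1},
     neg_edges = neg_edges H1
       \<union> {copy_node H1 H2 i ` e | i e. i < num_nodes H1 \<and> e \<in> neg_edges H2}
       \<union> {{i, copy_node H1 H2 i w} | i w. i < num_nodes H1 \<and> w < num_nodes H2 \<and>
            marking H1 i * marking H2 w = -1} \<rparr>"

fun corona_graph :: "sgraph \<Rightarrow> nat \<Rightarrow> sgraph" where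
  "corona_graph G 0 = G"
| "corona_graph G (Suc m) = corona (corona_graph G m) G"

text \<open>The two-valued function \<open>f\<close> with parameters \<open>n\<close> and \<open>d\<close> (the common negative degree), and
  its \<open>i\<close>-fold composition; values are collected with multiplicity.\<close>

definition f_vals :: "nat \<Rightarrow> nat \<Rightarrow> real \<Rightarrow> real multiset" where
  "f_vals n d x =
     (let b = 2 * real d + 1 + x + real n;
          r = sqrt (((2 * real d + 1) - (x + real n))\<^sup>2 + 4 * real n)
      in {# (b + r) / 2, (b - r) / 2 #})"

fun f_iter :: "nat \<Rightarrow> nat \<Rightarrow> nat \<Rightarrow> real \<Rightarrow> real multiset" where
  "f_iter n d 0 x = {#x#}"
| "f_iter n d (Suc i) x = (\<Sum>y \<in># f_iter n d i x. f_vals n d y)"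

end

theory Submission
  imports Defs
begin

text \<open>Order the nodes of \<open>H \<circ> G\<close> as in \<open>corona\<close>, and let \<open>N\<close>, \<open>n\<close> be the numbers of nodes of \<open>H\<close>, \<open>G\<close>.
  Then \<open>t I - L(H \<circ> G)\<close> has the diagonal blocks \<open>(t - n) I - L(H)\<close> and \<open>N\<close> copies of
  \<open>M = (t - 1) I - L(G)\<close>; the \<open>i\<close>-th copy is joined to node \<open>i\<close> by a constant vector \<open>\<plusminus>1\<close>. As all row
  sums of \<open>L(G)\<close> are \<open>2 d\<close>, these vectors are eigenvectors of \<open>M\<close> for \<open>r = t - 1 - 2 d\<close>, so
  eliminating the copies changes the first block by \<open>- (n / r) I\<close> only, whatever the signs are. Hence
  \<open>\<chi>\<^sub>H\<^sub>\<circ>\<^sub>G(t) = \<chi>\<^sub>H(t - n - n / r) \<chi>\<^sub>G(t - 1)\<^sup>N\<close>. One factor \<open>r\<close> of each \<open>\<chi>\<^sub>G(t - 1)\<close>, coming from the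
  eigenvalue \<open>2 d\<close>, clears the denominator of a factor of \<open>\<chi>\<^sub>H\<close>, and \<open>(t - n - \<lambda>) r - n\<close> is the quadratic
  polynomial with the roots \<open>f(\<lambda>)\<close>. The theorem follows by iteration.\<close>

subsection \<open>Products of linear factors\<close>

text \<open>Dividing out one root at a time lowers the degree and the number of roots together, so a
  monic polynomial with as many roots as its degree splits. This makes a listed spectrum into a
  factorization of the characteristic polynomial.\<close>

lemma prod_linear_factors_proots:
  fixes p :: "'a :: idom poly"
  assumes "monic p" "size (proots p) = degree p"
  shows "p = (\<Prod>x\<in>#proots p. [:- x, 1:])"
  using assms
proof (induction "degree p" arbitrary: p)
  case 0
  then have "p = 1"
    by (simp add: monic_degree_0)
  then show ?case by simp
next
  case (Suc k)
  then obtain x where "x \<in># proots p"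
    by (metis Zero_not_Suc multiset_nonemptyE size_empty)
  moreover from Suc have "p \<noteq> 0" by auto
  ultimately have "poly p x = 0" by simp
  then obtain q where q: "p = [:- x, 1:] * q"
    by (metis dvdE poly_eq_0_iff_dvd)
  with \<open>p \<noteq> 0\<close> have "q \<noteq> 0" by auto
  have roots: "proots p = add_mset x (proots q)"
    unfolding q using \<open>q \<noteq> 0\<close> by (subst proots_mult) auto
  have "degree p = Suc (degree q)"
    unfolding q using \<open>q \<noteq> 0\<close> by (subst degree_mult_eq) auto
  moreover have "monic q"
    using Suc.prems(1) unfolding q by (simp only: lead_coeff_mult) simp
  ultimately have "q = (\<Prod>x\<in>#proots q. [:- x, 1:])"
    using Suc.hyps(2) Suc.prems(2) roots by (intro Suc.hyps(1)) auto
  with q show ?case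
    unfolding roots by (metis image_mset_add_mset prod_mset.add_mset)
qed

lemma prod_linear_factors_nonzero:
  fixes M :: "'a :: idom multiset"
  shows "(\<Prod>x\<in>#M. [:- x, 1:]) \<noteq> 0"
  by (auto simp: prod_mset_zero_iff)

lemma degree_prod_linear_factors:
  fixes M :: "'a :: idom multiset"
  shows "degree (\<Prod>x\<in>#M. [:- x, 1:]) = size M"
proof (induction M)
  case (add x M)
  then show ?case
    using prod_linear_factors_nonzero[of M] by (simp del: mult_pCons_left add: degree_mult_eq)
qed simp

lemma proots_prod_linear_factors:
  fixes M :: "'a :: idom multiset"
  shows "proots (\<Prod>x\<in>#M. [:- x, 1:]) = M"
proof (induction M)
  case (add x M)
  then show ?case
    using prod_linear_factors_nonzero[of M] by (simp del: mult_pCons_left add: proots_mult)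
qed simp

lemma poly_prod_linear_factors:
  "poly (\<Prod>x\<in>#M. [:- x, 1:]) t = (\<Prod>x\<in>#M. t - x)"
  for t :: "'a :: comm_ring_1"
  by (induction M) (auto simp: algebra_simps)

text \<open>Multiplying by \<open>[:- a, 1:]\<close> forces agreement at \<open>a\<close> too, and
  polynomial functions determine polynomials in characteristic 0. It extends the corona formula to
  the value of \<open>t\<close> at which the elimination divides by zero.\<close>

lemma poly_eqI_except_point:
  fixes p q :: "'a :: {idom, ring_char_0} poly"
  assumes "\<And>t. t \<noteq> a \<Longrightarrow> poly p t = poly q t"
  shows "p = q"
proof -
  have "poly ([:- a, 1:] * p) = poly ([:- a, 1:] * q)"
  proof
    show "poly ([:- a, 1:] * p) t = poly ([:- a, 1:] * q) t" for t
      using assms[of t] by (cases "t = a") simp_all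
  qed
  then have "[:- a, 1:] * p = [:- a, 1:] * q"
    by (simp only: poly_eq_poly_eq_iff)
  then show ?thesis
    by (metis mult_cancel_left pCons_eq_0_iff zero_neq_one)
qed

subsection \<open>Determinants of block matrices\<close>

lemma poly_char_poly:
  fixes A :: "'a :: field mat"
  assumes "A \<in> carrier_mat n n"
  shows "poly (char_poly A) t = det (t \<cdot>\<^sub>m 1\<^sub>m n - A)"
proof -
  have "- char_matrix A t = t \<cdot>\<^sub>m 1\<^sub>m n - A"
    using assms by (intro eq_matI) (auto simp: char_matrix_def)
  then show ?thesis
    using char_poly_matrix[OF assms] by simp
qed

text \<open>A block column operation, that is, multiplication by the unipotent matrix
  \<open>?E\<close>, clears the lower left block. This is the Schur complement with a solution
  \<open>W\<close> of \<open>C * W = - T\<close> in place of an inverse, so \<open>C\<close> may be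
  singular.\<close>

lemma det_four_block_mat_eliminate:
  fixes B :: "'a :: idom mat"
  assumes B: "B \<in> carrier_mat n n" and S: "S \<in> carrier_mat n k"
    and T: "T \<in> carrier_mat k n" and C: "C \<in> carrier_mat k k"
    and W: "W \<in> carrier_mat k n" and "T + C * W = 0\<^sub>m k n"
  shows "det (four_block_mat B S T C) = det (B + S * W) * det C"
proof -
  let ?E = "four_block_mat (1\<^sub>m n) (0\<^sub>m n k) W (1\<^sub>m k)"
  have "det ?E = 1"
    using W by (subst det_four_block_mat_upper_right_zero[of _ n _ k]) auto
  then have "det (four_block_mat B S T C) = det (four_block_mat B S T C * ?E)"
    using B S T C W by (subst det_mult[of _ "n + k"]) auto
  also have "four_block_mat B S T C * ?E = four_block_mat (B + S * W) S (0\<^sub>m k n) C"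
    using assms by (subst mult_four_block_mat[of _ n n _ k _ k _ _ n _ k]) auto
  also have "det \<dots> = det (B + S * W) * det C"
    using assms by (intro det_four_block_mat_lower_left_zero) auto
  finally show ?thesis .
qed

text \<open>The Kronecker product of the identity of size \<open>N\<close> with \<open>M\<close>.
  Index \<open>p\<close> stands for node \<open>p mod n\<close> of copy \<open>p div n\<close>,
  which is the labelling of \<open>copy_node\<close> without its offset.\<close>

definition block_diagonal :: "nat \<Rightarrow> nat \<Rightarrow> 'a :: zero mat \<Rightarrow> 'a mat" where
  "block_diagonal N n M = mat (N * n) (N * n)
     (\<lambda>(p, q). if p div n = q div n then M $$ (p mod n, q mod n) else 0)"

definition block_row :: "nat \<Rightarrow> nat \<Rightarrow> (nat \<Rightarrow> 'a :: zero) \<Rightarrow> 'a mat" where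
  "block_row N n u = mat N (N * n) (\<lambda>(i, q). if q div n = i then u i else 0)"

lemma block_carrier [simp]:
  "block_diagonal N n M \<in> carrier_mat (N * n) (N * n)"
  "block_row N n u \<in> carrier_mat N (N * n)"
  by (auto simp: block_diagonal_def block_row_def)

text \<open>The first block is split off; the remaining indices, shifted down by \<open>n\<close>,
  lose exactly one from their quotient by \<open>n\<close> and keep their remainder.\<close>

lemma det_block_diagonal:
  fixes M :: "'a :: idom mat"
  assumes M: "M \<in> carrier_mat n n"
  shows "det (block_diagonal N n M) = det M ^ N"
proof (induction N)
  case 0
  have "block_diagonal 0 n M = 1\<^sub>m 0"
    by (intro eq_matI) (auto simp: block_diagonal_def)
  then show ?case by simp
next
  case (Suc N)
  have "block_diagonal (Suc N) n M =
      four_block_mat M (0\<^sub>m n (N * n)) (0\<^sub>m (N * n) n) (block_diagonal N n M)"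
    (is "?L = ?R")
  proof (intro eq_matI)
    fix p q assume "p < dim_row ?R" "q < dim_col ?R"
    then have p: "p < n + N * n" and q: "q < n + N * n"
      using M by (auto simp: block_diagonal_def)
    then have "0 < n" by (cases n) auto
    have split: "x div n = Suc ((x - n) div n)" "x mod n = (x - n) mod n" if "\<not> x < n" for x
      using that \<open>0 < n\<close> by (simp_all add: le_div_geq le_mod_geq)
    show "?L $$ (p, q) = ?R $$ (p, q)"
      using M p q \<open>0 < n\<close> split[of p] split[of q]
      by (cases "p < n"; cases "q < n") (simp_all add: block_diagonal_def)
  qed (use M in \<open>auto simp: block_diagonal_def\<close>)
  also have "det \<dots> = det M * det (block_diagonal N n M)"
    using M by (intro det_four_block_mat_lower_left_zero) auto
  finally show ?case using Suc by simp
qed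

lemma block_index_less:
  fixes p N n :: nat
  assumes "p < N * n"
  shows "0 < n" "p div n < N" "p mod n < n"
proof -
  show "0 < n" using assms by (cases n) auto
  then show "p mod n < n" by simp
  show "p div n < N" using assms by (rule less_mult_imp_div_less)
qed

lemma sum_lessThan_add:
  fixes f :: "nat \<Rightarrow> 'a :: comm_monoid_add"
  shows "(\<Sum>j<N + M. f j) = (\<Sum>j<N. f j) + (\<Sum>j<M. f (N + j))"
  by (induction M) (auto simp: add.assoc)

text \<open>Rewriting a sum over all copy nodes as a sum over copies and nodes lets the conditions
  on the copy index collapse the outer sum.\<close>

lemma sum_block:
  fixes f :: "nat \<Rightarrow> nat \<Rightarrow> 'a :: comm_monoid_add"
  shows "(\<Sum>q<N * n. f (q div n) (q mod n)) = (\<Sum>k<N. \<Sum>w<n. f k w)"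
proof -
  have "(\<Sum>q = k * n..<k * n + n. f (q div n) (q mod n)) = (\<Sum>w<n. f k w)" for k
  proof -
    have "(\<Sum>q = k * n..<k * n + n. f (q div n) (q mod n)) =
        (\<Sum>w = 0..<n. f ((w + k * n) div n) ((w + k * n) mod n))"
      using sum.shift_bounds_nat_ivl[of "\<lambda>q. f (q div n) (q mod n)" 0 "k * n" n]
      by (simp add: add.commute)
    then show ?thesis
      by (simp add: atLeast0LessThan)
  qed
  then show ?thesis
    by (simp flip: sum.nat_group)
qed

text \<open>Constant row sums make the all-ones vector an eigenvector of \<open>M\<close> for
  \<open>r\<close>. Hence \<open>- 1 / r\<close> times the transposed joining block solves the
  elimination equation, and the product of the joining block with its transpose is \<open>n\<close>
  times the identity because each \<open>u i\<close> squares to 1.\<close>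

lemma det_corona_block:
  fixes M A :: "'a :: field mat"
  assumes A: "A \<in> carrier_mat N N" and M: "M \<in> carrier_mat n n"
    and rows: "\<And>v. v < n \<Longrightarrow> (\<Sum>w<n. M $$ (v, w)) = r" and "r \<noteq> 0"
    and u: "\<And>i. i < N \<Longrightarrow> u i * u i = 1"
  shows "det (four_block_mat A (block_row N n u) (transpose_mat (block_row N n u))
      (block_diagonal N n M)) = det (A - (of_nat n / r) \<cdot>\<^sub>m 1\<^sub>m N) * det M ^ N"
proof -
  let ?S = "block_row N n u" and ?C = "block_diagonal N n M"
  let ?W = "(- 1 / r) \<cdot>\<^sub>m transpose_mat ?S"
  have W: "?W \<in> carrier_mat (N * n) N"
    by simp
  have "transpose_mat ?S + ?C * ?W = 0\<^sub>m (N * n) N"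
  proof (intro eq_matI)
    fix p i assume "p < dim_row (0\<^sub>m (N * n) N :: 'a mat)" "i < dim_col (0\<^sub>m (N * n) N :: 'a mat)"
    then have p: "p < N * n" and i: "i < N" by auto
    note pn = block_index_less[OF p]
    have "(?C * ?W) $$ (p, i) = (\<Sum>q<N * n. ?C $$ (p, q) * ?W $$ (q, i))"
      using p i W by (simp add: scalar_prod_def block_diagonal_def block_row_def atLeast0LessThan)
    also have "\<dots> = (\<Sum>q<N * n. (if p div n = q div n then M $$ (p mod n, q mod n) else 0) *
        (- 1 / r * (if q div n = i then u i else 0)))"
      using p i by (intro sum.cong) (auto simp: block_diagonal_def block_row_def)
    also have "\<dots> = (\<Sum>k<N. \<Sum>w<n. (if p div n = k then M $$ (p mod n, w) else 0) *
        (- 1 / r * (if k = i then u i else 0)))"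
      by (rule sum_block)
    \<comment> \<open>For \<open>k = p div n\<close> the inner sum is a row sum of \<open>M\<close>,
      whose value \<open>r\<close> cancels the denominator.\<close>
    also have "\<dots> = (\<Sum>k<N. if k = p div n then - (if k = i then u i else 0) else 0)"
      using rows[OF pn(3)] \<open>r \<noteq> 0\<close>
      by (intro sum.cong) (auto simp flip: sum_distrib_right sum_divide_distrib simp: sum_negf)
    also have "\<dots> = - (if p div n = i then u i else 0)"
      using pn by simp
    finally show "(transpose_mat ?S + ?C * ?W) $$ (p, i) = 0\<^sub>m (N * n) N $$ (p, i)"
      using p i by (simp add: block_row_def block_diagonal_def)
  qed (auto simp: block_row_def block_diagonal_def)
  then have "det (four_block_mat A ?S (transpose_mat ?S) ?C) = det (A + ?S * ?W) * det ?C"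
    using A W by (intro det_four_block_mat_eliminate) auto
  also have "A + ?S * ?W = A - (of_nat n / r) \<cdot>\<^sub>m 1\<^sub>m N"
  proof (intro eq_matI)
    fix i j assume "i < dim_row (A - (of_nat n / r) \<cdot>\<^sub>m 1\<^sub>m N)" "j < dim_col (A - (of_nat n / r) \<cdot>\<^sub>m 1\<^sub>m N)"
    then have i: "i < N" and j: "j < N" by auto
    have "(?S * ?W) $$ (i, j) = (\<Sum>q<N * n. ?S $$ (i, q) * ?W $$ (q, j))"
      using i j W by (simp add: scalar_prod_def block_row_def atLeast0LessThan)
    also have "\<dots> = (\<Sum>q<N * n. (if q div n = i then u i else 0) *
        (- 1 / r * (if q div n = j then u j else 0)))"
      using i j by (intro sum.cong) (auto simp: block_row_def)
    also have "\<dots> = (\<Sum>k<N. \<Sum>w<n. (if k = i then u i else 0) *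
        (- 1 / r * (if k = j then u j else 0)))"
      by (rule sum_block)
    \<comment> \<open>Only \<open>k = i = j\<close> survives; its \<open>n\<close> equal terms carry
      \<open>u i * u i = 1\<close>, so the signs vanish here.\<close>
    also have "\<dots> = (\<Sum>k<N. if k = i then if i = j then - (of_nat n / r) else 0 else 0)"
      using i u by (intro sum.cong) auto
    also have "\<dots> = (if i = j then - (of_nat n / r) else 0)"
      using i by simp
    finally show "(A + ?S * ?W) $$ (i, j) = (A - (of_nat n / r) \<cdot>\<^sub>m 1\<^sub>m N) $$ (i, j)"
      using A i j by (simp add: block_row_def)
  qed (use A in \<open>auto simp: block_row_def\<close>)
  finally show ?thesis
    by (simp add: det_block_diagonal[OF M])
qed

subsection \<open>Edges and Laplacian of a corona\<close>

text \<open>The condition of \<open>signed_graph\<close> on a single sign class, so that positive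
  and negative edges share the same lemmas.\<close>

definition edge_set :: "nat \<Rightarrow> nat set set \<Rightarrow> bool" where
  "edge_set N E \<longleftrightarrow> (\<forall>e\<in>E. e \<subseteq> {..<N} \<and> card e = 2)"

lemma edge_setE:
  assumes "edge_set N E" "e \<in> E"
  obtains a b where "e = {a, b}" "a \<noteq> b" "a < N" "b < N"
proof -
  have "card e = 2" "e \<subseteq> {..<N}"
    using assms by (auto simp: edge_set_def)
  then show thesis
    using that by (metis card_2_iff insert_subset lessThan_iff)
qed

lemma signed_graph_edge_sets:
  "signed_graph G \<longleftrightarrow> edge_set (num_nodes G) (pos_edges G) \<and>
     edge_set (num_nodes G) (neg_edges G) \<and> pos_edges G \<inter> neg_edges G = {}"
  by (auto simp: signed_graph_def edge_set_def edges_def)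

text \<open>The bijection \<open>j \<mapsto> {v, j}\<close> turns a count of edges into a count of
  neighbours, which can be summed along a row of a matrix.\<close>

lemma card_incident_edges:
  assumes "edge_set N E"
  shows "card {e \<in> E. v \<in> e} = card {j. j < N \<and> {v, j} \<in> E}"
proof -
  have "bij_betw (\<lambda>j. {v, j}) {j. j < N \<and> {v, j} \<in> E} {e \<in> E. v \<in> e}"
  proof (rule bij_betw_imageI)
    show "inj_on (\<lambda>j. {v, j}) {j. j < N \<and> {v, j} \<in> E}"
      by (auto simp: inj_on_def doubleton_eq_iff)
    show "(\<lambda>j. {v, j}) ` {j. j < N \<and> {v, j} \<in> E} = {e \<in> E. v \<in> e}"
    proof (intro equalityI subsetI)
      fix e assume "e \<in> {e \<in> E. v \<in> e}"
      then have e: "e \<in> E" "v \<in> e" by auto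
      then obtain a b where ab: "e = {a, b}" "a < N" "b < N"
        using assms by (elim edge_setE)
      with e have "e = {v, a} \<or> e = {v, b}" by auto
      with ab(2,3) obtain j where "e = {v, j}" "j < N" by metis
      with e show "e \<in> (\<lambda>j. {v, j}) ` {j. j < N \<and> {v, j} \<in> E}" by simp
    qed auto
  qed
  from bij_betw_same_card[OF this] show ?thesis by simp
qed

text \<open>Common shape of the two sign classes of a corona: \<open>E\<close> and \<open>F\<close>
  are the edges of that sign in the two factors, and \<open>P\<close> selects the joining edges of
  that sign.\<close>

definition corona_edges ::
    "nat \<Rightarrow> nat \<Rightarrow> nat set set \<Rightarrow> nat set set \<Rightarrow> (nat \<Rightarrow> nat \<Rightarrow> bool) \<Rightarrow> nat set set" where
  "corona_edges N n E F P = E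
     \<union> {(\<lambda>w. N + k * n + w) ` e | k e. k < N \<and> e \<in> F}
     \<union> {{k, N + k * n + w} | k w. k < N \<and> w < n \<and> P k w}"

text \<open>With explicit end points for each kind of edge, membership questions become comparisons
  of node labels.\<close>

lemma corona_edges_cases [consumes 3, case_names base copy joining]:
  assumes "e \<in> corona_edges N n E F P" "edge_set N E" "edge_set n F"
  obtains
    (base) i j where "e = {i, j}" "i \<noteq> j" "i < N" "j < N" "e \<in> E"
  | (copy) k w w' where "e = {N + k * n + w, N + k * n + w'}" "w \<noteq> w'" "k < N" "w < n" "w' < n"
      "{w, w'} \<in> F"
  | (joining) k w where "e = {k, N + k * n + w}" "k < N" "w < n" "P k w"
proof -
  consider "e \<in> E" | k f where "e = (\<lambda>w. N + k * n + w) ` f" "k < N" "f \<in> F"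
    | k w where "e = {k, N + k * n + w}" "k < N" "w < n" "P k w"
    using assms(1) by (auto simp: corona_edges_def)
  then show thesis
  proof cases
    case 1
    then show thesis
      using assms(2) base by (metis edge_setE)
  next
    case 2
    moreover obtain a b where "f = {a, b}" "a \<noteq> b" "a < n" "b < n"
      using 2 assms(3) by (metis edge_setE)
    ultimately show thesis
      using copy[of k a b] by auto
  qed (use joining in blast)
qed

lemma block_index_eq_iff:
  fixes k w k' w' n :: nat
  assumes "w < n" "w' < n"
  shows "k * n + w = k' * n + w' \<longleftrightarrow> k = k' \<and> w = w'"
proof
  assume eq: "k * n + w = k' * n + w'"
  have "(k * n + w) div n = k" "(k' * n + w') div n = k'"
    using assms by auto
  with eq have "k = k'" by simp
  with eq show "k = k' \<and> w = w'" by simp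
qed simp

lemma base_edge_in_corona_edges_iff:
  assumes "edge_set N E" "edge_set n F" "i < N" "j < N"
  shows "{i, j} \<in> corona_edges N n E F P \<longleftrightarrow> {i, j} \<in> E"
proof
  assume "{i, j} \<in> corona_edges N n E F P"
  then show "{i, j} \<in> E"
    using assms by (cases rule: corona_edges_cases) (auto simp: doubleton_eq_iff)
qed (auto simp: corona_edges_def)

lemma joining_edge_in_corona_edges_iff:
  assumes "edge_set N E" "edge_set n F" "i < N" "k < N" "w < n"
  shows "{i, N + k * n + w} \<in> corona_edges N n E F P \<longleftrightarrow> i = k \<and> P i w"
proof
  assume "{i, N + k * n + w} \<in> corona_edges N n E F P"
  then show "i = k \<and> P i w"
    using assms
    by (cases rule: corona_edges_cases)
      (auto simp: doubleton_eq_iff add.assoc block_index_eq_iff)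
qed (use assms in \<open>auto simp: corona_edges_def\<close>)

lemma copy_edge_in_corona_edges_iff:
  assumes "edge_set N E" "edge_set n F" "k < N" "w < n" "k' < N" "w' < n"
  shows "{N + k * n + w, N + k' * n + w'} \<in> corona_edges N n E F P \<longleftrightarrow>
    k = k' \<and> {w, w'} \<in> F"
proof
  assume "{N + k * n + w, N + k' * n + w'} \<in> corona_edges N n E F P"
  then show "k = k' \<and> {w, w'} \<in> F"
    using assms
    by (cases rule: corona_edges_cases)
      (auto simp: doubleton_eq_iff add.assoc block_index_eq_iff insert_commute)
next
  assume "k = k' \<and> {w, w'} \<in> F"
  moreover have "{N + k * n + w, N + k * n + w'} = (\<lambda>v. N + k * n + v) ` {w, w'}"
    by simp
  ultimately show "{N + k * n + w, N + k' * n + w'} \<in> corona_edges N n E F P"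
    using assms unfolding corona_edges_def by blast
qed

text \<open>Membership in terms of the offsets \<open>p\<close> and \<open>q\<close> past the base
  nodes, which are the indices of the block matrices.\<close>

lemma corona_edges_block_iff:
  assumes "edge_set N E" "edge_set n F" "q < N * n"
  shows "i < N \<Longrightarrow> {i, N + q} \<in> corona_edges N n E F P \<longleftrightarrow> i = q div n \<and> P i (q mod n)"
    and "p < N * n \<Longrightarrow> {N + p, N + q} \<in> corona_edges N n E F P \<longleftrightarrow>
      p div n = q div n \<and> {p mod n, q mod n} \<in> F"
  using joining_edge_in_corona_edges_iff[OF assms(1,2), of i "q div n" "q mod n" P]
    copy_edge_in_corona_edges_iff[OF assms(1,2), of "p div n" "p mod n" "q div n" "q mod n" P]
    block_index_less[OF assms(3)] block_index_less[of p N n]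
  by (simp_all add: add.assoc)

lemma copy_index_less:
  fixes N n k w :: nat
  assumes "k < N" "w < n"
  shows "N + k * n + w < N + N * n"
proof -
  have "k * n + w < Suc k * n" using assms by simp
  also have "\<dots> \<le> N * n" using assms by (intro mult_le_mono1) simp
  finally show ?thesis by simp
qed

lemma edge_set_corona_edges:
  assumes "edge_set N E" "edge_set n F"
  shows "edge_set (N + N * n) (corona_edges N n E F P)"
  unfolding edge_set_def
proof
  fix e assume "e \<in> corona_edges N n E F P"
  then show "e \<subseteq> {..<N + N * n} \<and> card e = 2"
    using assms
    by (cases rule: corona_edges_cases) (auto simp: copy_index_less trans_less_add1)
qed

text \<open>The labels of the end points determine the kind of an edge, so disjointness can be
  checked separately for base, copy and joining edges.\<close>

lemma corona_edges_disjoint: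
  assumes "edge_set N E" "edge_set n F" "edge_set N E'" "edge_set n F'"
    and "E \<inter> E' = {}" "F \<inter> F' = {}" "\<And>k w. P k w \<Longrightarrow> \<not> P' k w"
  shows "corona_edges N n E F P \<inter> corona_edges N n E' F' P' = {}"
proof -
  have "e \<notin> corona_edges N n E' F' P'" if "e \<in> corona_edges N n E F P" for e
    using that assms(1,2)
    by (cases rule: corona_edges_cases)
      (use assms in \<open>auto simp: base_edge_in_corona_edges_iff joining_edge_in_corona_edges_iff
        copy_edge_in_corona_edges_iff\<close>)
  then show ?thesis by auto
qed

section \<open>The corona as a signed graph\<close>

lemma pos_edges_corona:
  "pos_edges (corona H G) = corona_edges (num_nodes H) (num_nodes G) (pos_edges H) (pos_edges G)
     (\<lambda>k w. marking H k * marking G w = 1)"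
  by (simp add: corona_def corona_edges_def copy_node_def[abs_def])

lemma neg_edges_corona:
  "neg_edges (corona H G) = corona_edges (num_nodes H) (num_nodes G) (neg_edges H) (neg_edges G)
     (\<lambda>k w. marking H k * marking G w = -1)"
  by (simp add: corona_def corona_edges_def copy_node_def[abs_def])

lemma num_nodes_corona [simp]:
  "num_nodes (corona H G) = num_nodes H + num_nodes H * num_nodes G"
  by (simp add: corona_def)

lemma signed_graph_corona:
  assumes "signed_graph H" "signed_graph G"
  shows "signed_graph (corona H G)"
proof -
  have "pos_edges (corona H G) \<inter> neg_edges (corona H G) = {}"
    unfolding pos_edges_corona neg_edges_corona
    using assms by (intro corona_edges_disjoint) (auto simp: signed_graph_edge_sets)
  then show ?thesis
    using assms by (auto simp: signed_graph_edge_sets pos_edges_corona neg_edges_corona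
        intro: edge_set_corona_edges)
qed

lemma marking_abs: "\<bar>marking G v\<bar> = 1"
  unfolding marking_def abs_prod by (intro prod.neutral) (simp add: edge_sign_def)

lemma marking_cases: "marking G v = 1 \<or> marking G v = -1"
  using marking_abs[of G v] by linarith

section \<open>Entries of the adjacency matrix and the signed Laplacian\<close>

lemma adjacency_matrix_carrier [simp]:
  "adjacency_matrix G \<in> carrier_mat (num_nodes G) (num_nodes G)"
  by (simp add: adjacency_matrix_def)

lemma signed_laplacian_carrier [simp]:
  "signed_laplacian G \<in> carrier_mat (num_nodes G) (num_nodes G)"
  by (simp add: signed_laplacian_def minus_carrier_mat)

lemma dim_signed_laplacian [simp]:
  "dim_row (signed_laplacian G) = num_nodes G" "dim_col (signed_laplacian G) = num_nodes G"
  using signed_laplacian_carrier by blast+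

lemma adjacency_matrix_entry:
  assumes "i < num_nodes G" "j < num_nodes G"
  shows "adjacency_matrix G $$ (i, j) =
    (if {i, j} \<in> pos_edges G then 1 else if {i, j} \<in> neg_edges G then -1 else 0)"
  using assms by (simp add: adjacency_matrix_def edges_def edge_sign_def)

text \<open>No edge has both signs, so the total degree of a node is the sum of the absolute values
  in its adjacency row. The Laplacian of a corona can thus be computed from its adjacency matrix
  alone.\<close>

lemma signed_laplacian_entry:
  assumes "signed_graph G" "i < num_nodes G" "j < num_nodes G"
  shows "signed_laplacian G $$ (i, j) =
    (if i = j then \<Sum>k<num_nodes G. \<bar>adjacency_matrix G $$ (i, k)\<bar> else 0)
      - adjacency_matrix G $$ (i, j)"
proof -
  let ?N = "num_nodes G"
  have card: "real (card {k. k < ?N \<and> {i, k} \<in> E}) = (\<Sum>k<?N. if {i, k} \<in> E then 1 else 0)" for E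
    by (subst sum.inter_filter[symmetric]) (auto intro: arg_cong[where f = card])
  have "real (pos_degree G i + neg_degree G i) =
      (\<Sum>k<?N. (if {i, k} \<in> pos_edges G then 1 else 0) + (if {i, k} \<in> neg_edges G then 1 else 0))"
    using assms(1)[unfolded signed_graph_edge_sets]
    by (simp add: pos_degree_def neg_degree_def card_incident_edges[of ?N] sum.distrib flip: card)
  also have "\<dots> = (\<Sum>k<?N. \<bar>adjacency_matrix G $$ (i, k)\<bar>)"
    using assms by (intro sum.cong) (auto simp: adjacency_matrix_entry signed_graph_edge_sets)
  finally show ?thesis
    using assms by (auto simp: signed_laplacian_def degree_matrix_def adjacency_matrix_def)
qed

text \<open>For an adjacency entry \<open>a\<close>, the difference \<open>\<bar>a\<bar> - a\<close>
  is 2 on negative edges and 0 otherwise.\<close>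

lemma signed_laplacian_row_sum:
  assumes G: "signed_graph G" and v: "v < num_nodes G"
  shows "(\<Sum>w<num_nodes G. signed_laplacian G $$ (v, w)) = 2 * real (neg_degree G v)"
proof -
  let ?N = "num_nodes G"
  have "(\<Sum>w<?N. signed_laplacian G $$ (v, w)) =
      (\<Sum>w<?N. if v = w then \<Sum>k<?N. \<bar>adjacency_matrix G $$ (v, k)\<bar> else 0)
        - (\<Sum>w<?N. adjacency_matrix G $$ (v, w))"
    using G v by (simp add: signed_laplacian_entry sum_subtractf)
  also have "\<dots> = (\<Sum>w<?N. \<bar>adjacency_matrix G $$ (v, w)\<bar> - adjacency_matrix G $$ (v, w))"
    using v by (simp add: sum_subtractf)
  also have "\<dots> = (\<Sum>w<?N. if {v, w} \<in> neg_edges G then 2 else 0)"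
    using G v by (intro sum.cong) (auto simp: adjacency_matrix_entry signed_graph_edge_sets)
  also have "\<dots> = 2 * real (card {w. w < ?N \<and> {v, w} \<in> neg_edges G})"
    by (subst sum.inter_filter[symmetric]) (auto intro: arg_cong[where f = card])
  also have "\<dots> = 2 * real (neg_degree G v)"
    using G by (simp add: neg_degree_def card_incident_edges[of ?N] signed_graph_edge_sets)
  finally show ?thesis .
qed

text \<open>As all nodes of \<open>G\<close> have the marking \<open>c\<close>, the edges from node
  \<open>i\<close> to its copy all have the sign \<open>marking H i * c\<close>; this makes the
  joining block a \<open>block_row\<close>.\<close>

lemma adjacency_matrix_corona:
  assumes H: "signed_graph H" and G: "signed_graph G"
    and c: "\<forall>w<num_nodes G. marking G w = c" and c1: "c = 1 \<or> c = -1"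
  defines "N \<equiv> num_nodes H" and "n \<equiv> num_nodes G"
  shows "adjacency_matrix (corona H G) =
    four_block_mat (adjacency_matrix H) (block_row N n (\<lambda>i. of_int (marking H i * c)))
      (transpose_mat (block_row N n (\<lambda>i. of_int (marking H i * c))))
      (block_diagonal N n (adjacency_matrix G))" (is "_ = four_block_mat ?A ?S ?T ?C")
proof -
  note wf = H[unfolded signed_graph_edge_sets, folded N_def] G[unfolded signed_graph_edge_sets, folded n_def]
  have u: "marking H i * c = 1 \<or> marking H i * c = -1" for i
    using c1 marking_cases[of H i] by auto
  have entry: "adjacency_matrix (corona H G) $$ (i, j) =
      (if {i, j} \<in> pos_edges (corona H G) then 1
       else if {i, j} \<in> neg_edges (corona H G) then -1 else 0)"
    if "i < N + N * n" "j < N + N * n" for i j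
    using that by (intro adjacency_matrix_entry) (simp_all add: N_def n_def)
  note edges = pos_edges_corona[of H G, folded N_def n_def]
    neg_edges_corona[of H G, folded N_def n_def]
  have base: "adjacency_matrix (corona H G) $$ (i, j) = adjacency_matrix H $$ (i, j)"
    if "i < N" "j < N" for i j
    using that wf adjacency_matrix_entry[of i H j, folded N_def]
    by (simp add: entry edges base_edge_in_corona_edges_iff)
  have joining: "adjacency_matrix (corona H G) $$ (i, N + q) =
      (if q div n = i then of_int (marking H i * c) else 0)" if "i < N" "q < N * n" for i q
  proof -
    have "c = marking G (q mod n)"
      using block_index_less[OF that(2)] c by (simp add: n_def)
    then show ?thesis
      using that wf u[of i]
      by (auto simp: entry edges corona_edges_block_iff simp del: of_int_mult)
  qed
  have copy: "adjacency_matrix (corona H G) $$ (N + p, N + q) =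
      (if p div n = q div n then adjacency_matrix G $$ (p mod n, q mod n) else 0)"
    if "p < N * n" "q < N * n" for p q
    using that wf block_index_less[OF that(1)] block_index_less[OF that(2)]
      adjacency_matrix_entry[of "p mod n" G "q mod n", folded n_def]
    by (simp add: entry edges corona_edges_block_iff)
  have sym: "adjacency_matrix (corona H G) $$ (i, j) = adjacency_matrix (corona H G) $$ (j, i)"
    if "i < N + N * n" "j < N + N * n" for i j
    using that by (simp add: entry insert_commute)
  show ?thesis
  proof (rule eq_matI)
    fix i j
    assume "i < dim_row (four_block_mat ?A ?S ?T ?C)" "j < dim_col (four_block_mat ?A ?S ?T ?C)"
    then have ij: "i < N + N * n" "j < N + N * n"
      by (auto simp: adjacency_matrix_def block_diagonal_def N_def)
    have dims: "dim_row ?A = N" "dim_col ?A = N" "dim_row ?C = N * n" "dim_col ?C = N * n"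
      by (auto simp: adjacency_matrix_def block_diagonal_def N_def)
    consider "i < N" "j < N" | q where "i < N" "j = N + q" "q < N * n"
      | q where "j < N" "i = N + q" "q < N * n"
      | p q where "i = N + p" "p < N * n" "j = N + q" "q < N * n"
      using ij by (metis add_less_cancel_left le_iff_add not_less)
    then show "adjacency_matrix (corona H G) $$ (i, j) = four_block_mat ?A ?S ?T ?C $$ (i, j)"
    proof cases
      case 1
      then show ?thesis using ij dims by (simp add: base)
    next
      case 2
      then show ?thesis using ij dims by (simp add: joining block_row_def)
    next
      case 3
      then show ?thesis using ij dims sym[OF ij] by (simp add: joining block_row_def)
    next
      case 4
      then show ?thesis using ij dims by (simp add: copy block_diagonal_def)
    qed
  qed (auto simp: adjacency_matrix_def block_diagonal_def N_def n_def)
qed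

text \<open>Joining adds \<open>n\<close> to the degree of each base node and 1 to that of each copy
  node, which accounts for the shifts \<open>t - n\<close> and \<open>t - 1\<close>. Off the
  diagonal \<open>t I - L\<close> equals the adjacency matrix, so the joining blocks keep their
  sign.\<close>

lemma characteristic_matrix_corona:
  assumes H: "signed_graph H" and G: "signed_graph G"
    and c: "\<forall>w<num_nodes G. marking G w = c" and c1: "c = 1 \<or> c = -1"
  defines "N \<equiv> num_nodes H" and "n \<equiv> num_nodes G"
  shows "t \<cdot>\<^sub>m 1\<^sub>m (N + N * n) - signed_laplacian (corona H G) =
    four_block_mat ((t - real n) \<cdot>\<^sub>m 1\<^sub>m N - signed_laplacian H)
      (block_row N n (\<lambda>i. of_int (marking H i * c)))
      (transpose_mat (block_row N n (\<lambda>i. of_int (marking H i * c))))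
      (block_diagonal N n ((t - 1) \<cdot>\<^sub>m 1\<^sub>m n - signed_laplacian G))"
    (is "_ = four_block_mat ?A ?S ?T ?C")
proof (rule eq_matI)
  let ?K = "corona H G"
  note adj = adjacency_matrix_corona[OF H G c c1, folded N_def n_def]
  have A_carrier: "adjacency_matrix H \<in> carrier_mat N N" "adjacency_matrix G \<in> carrier_mat n n"
    by (simp_all add: N_def n_def)
  have base: "adjacency_matrix ?K $$ (i, j) = adjacency_matrix H $$ (i, j)"
    if "i < N" "j < N" for i j
    using that A_carrier unfolding adj by (simp add: block_diagonal_def)
  have joining: "adjacency_matrix ?K $$ (i, N + q) =
      (if q div n = i then of_int (marking H i * c) else 0)"
      "adjacency_matrix ?K $$ (N + q, i) =
      (if q div n = i then of_int (marking H i * c) else 0)" if "i < N" "q < N * n" for i q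
    using that A_carrier unfolding adj by (simp_all add: block_diagonal_def block_row_def)
  have copy: "adjacency_matrix ?K $$ (N + p, N + q) =
      (if p div n = q div n then adjacency_matrix G $$ (p mod n, q mod n) else 0)"
    if "p < N * n" "q < N * n" for p q
    using that A_carrier unfolding adj by (simp add: block_diagonal_def)
  have u: "\<bar>real_of_int (marking H i) * real_of_int c\<bar> = 1" for i
    using c1 marking_cases[of H i] by auto
  have deg_base: "(\<Sum>k<N + N * n. \<bar>adjacency_matrix ?K $$ (i, k)\<bar>) =
      (\<Sum>k<N. \<bar>adjacency_matrix H $$ (i, k)\<bar>) + real n" if "i < N" for i
  proof -
    have "(\<Sum>q<N * n. \<bar>adjacency_matrix ?K $$ (i, N + q)\<bar>) =
        (\<Sum>q<N * n. if q div n = i then 1 else 0)"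
      using that u by (intro sum.cong) (auto simp: joining)
    also have "\<dots> = (\<Sum>k<N. \<Sum>w<n. if k = i then 1 else 0)"
      by (rule sum_block)
    also have "\<dots> = (\<Sum>k<N. if k = i then real n else 0)"
      by (intro sum.cong) auto
    finally show ?thesis
      using that by (simp add: sum_lessThan_add base)
  qed
  have deg_copy: "(\<Sum>k<N + N * n. \<bar>adjacency_matrix ?K $$ (N + p, k)\<bar>) =
      1 + (\<Sum>w<n. \<bar>adjacency_matrix G $$ (p mod n, w)\<bar>)" if "p < N * n" for p
  proof -
    note p = block_index_less[OF that]
    have "(\<Sum>q<N * n. \<bar>adjacency_matrix ?K $$ (N + p, N + q)\<bar>) =
        (\<Sum>q<N * n. if p div n = q div n then \<bar>adjacency_matrix G $$ (p mod n, q mod n)\<bar> else 0)"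
      using that by (intro sum.cong) (auto simp: copy)
    also have "\<dots> = (\<Sum>k<N. \<Sum>w<n. if p div n = k then \<bar>adjacency_matrix G $$ (p mod n, w)\<bar> else 0)"
      by (rule sum_block)
    also have "\<dots> = (\<Sum>k<N. if k = p div n then \<Sum>w<n. \<bar>adjacency_matrix G $$ (p mod n, w)\<bar> else 0)"
      by (intro sum.cong) auto
    also have "\<dots> = (\<Sum>w<n. \<bar>adjacency_matrix G $$ (p mod n, w)\<bar>)"
      using p by simp
    moreover have "(\<Sum>i<N. \<bar>adjacency_matrix ?K $$ (N + p, i)\<bar>) = (\<Sum>i<N. if i = p div n then 1 else 0)"
      using that u by (intro sum.cong) (auto simp: joining)
    ultimately show ?thesis
      using p by (simp add: sum_lessThan_add)
  qed
  fix i j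
  assume "i < dim_row (four_block_mat ?A ?S ?T ?C)" "j < dim_col (four_block_mat ?A ?S ?T ?C)"
  then have ij: "i < N + N * n" "j < N + N * n"
    by (auto simp: block_diagonal_def N_def)
  have dims: "dim_row ?A = N" "dim_col ?A = N" "dim_row ?C = N * n" "dim_col ?C = N * n"
    "dim_row (signed_laplacian ?K) = N + N * n" "dim_col (signed_laplacian ?K) = N + N * n"
    "dim_row (signed_laplacian G) = n" "dim_col (signed_laplacian G) = n"
    "dim_row (signed_laplacian H) = N" "dim_col (signed_laplacian H) = N"
    by (auto simp: block_diagonal_def N_def n_def)
  have L: "signed_laplacian ?K $$ (i, j) =
      (if i = j then \<Sum>k<N + N * n. \<bar>adjacency_matrix ?K $$ (i, k)\<bar> else 0)
        - adjacency_matrix ?K $$ (i, j)"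
    using ij signed_laplacian_entry[OF signed_graph_corona[OF H G], of i j]
    by (simp add: N_def n_def)
  have LH: "signed_laplacian H $$ (i, j) =
      (if i = j then \<Sum>k<N. \<bar>adjacency_matrix H $$ (i, k)\<bar> else 0) - adjacency_matrix H $$ (i, j)"
    if "i < N" "j < N"
    using that signed_laplacian_entry[OF H, of i j] by (simp add: N_def)
  have LG: "signed_laplacian G $$ (p, q) =
      (if p = q then \<Sum>k<n. \<bar>adjacency_matrix G $$ (p, k)\<bar> else 0) - adjacency_matrix G $$ (p, q)"
    if "p < n" "q < n" for p q
    using that signed_laplacian_entry[OF G, of p q] by (simp add: n_def)
  consider "i < N" "j < N" | q where "i < N" "j = N + q" "q < N * n"
    | q where "j < N" "i = N + q" "q < N * n"
    | p q where "i = N + p" "p < N * n" "j = N + q" "q < N * n"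
    using ij by (metis add_less_cancel_left le_iff_add not_less)
  then show "(t \<cdot>\<^sub>m 1\<^sub>m (N + N * n) - signed_laplacian ?K) $$ (i, j) =
      four_block_mat ?A ?S ?T ?C $$ (i, j)"
  proof cases
    case 1
    then show ?thesis using ij dims by (simp add: L LH base deg_base)
  next
    case 2
    then show ?thesis using ij dims L by (simp add: joining block_row_def)
  next
    case 3
    then show ?thesis using ij dims L by (simp add: joining block_row_def)
  next
    case 4
    note pn = block_index_less[OF 4(2)] block_index_less[OF 4(4)]
    \<comment> \<open>Diagonal positions of the large matrix are the diagonal positions inside its
      diagonal blocks.\<close>
    have "p = q \<longleftrightarrow> p div n = q div n \<and> p mod n = q mod n"
      by (metis div_mult_mod_eq)
    with 4 pn show ?thesis using ij dims L
      by (simp add: LG copy deg_copy block_diagonal_def)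
  qed
qed (auto simp: block_diagonal_def N_def n_def)

text \<open>The matrix \<open>?M\<close> has row sums \<open>t - 1 - 2 * d\<close>, and the
  condition on \<open>t\<close> makes them nonzero, as the elimination in
  \<open>det_corona_block\<close> requires.\<close>

lemma poly_char_poly_corona:
  assumes H: "signed_graph H" and G: "signed_graph G"
    and c: "\<forall>w<num_nodes G. marking G w = c" and c1: "c = 1 \<or> c = -1"
    and d: "\<forall>w<num_nodes G. neg_degree G w = d"
    and t: "t \<noteq> 2 * real d + 1"
  defines "N \<equiv> num_nodes H" and "n \<equiv> num_nodes G"
  shows "poly (char_poly (signed_laplacian (corona H G))) t =
    poly (char_poly (signed_laplacian H)) (t - real n - real n / (t - (2 * real d + 1))) *
    poly (char_poly (signed_laplacian G)) (t - 1) ^ N"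
proof -
  let ?A = "(t - real n) \<cdot>\<^sub>m 1\<^sub>m N - signed_laplacian H"
  let ?M = "(t - 1) \<cdot>\<^sub>m 1\<^sub>m n - signed_laplacian G"
  let ?r = "t - (2 * real d + 1)"
  let ?u = "\<lambda>i. real_of_int (marking H i * c)"
  have LH: "signed_laplacian H \<in> carrier_mat N N" and LG: "signed_laplacian G \<in> carrier_mat n n"
    by (simp_all add: N_def n_def)
  have K: "signed_laplacian (corona H G) \<in> carrier_mat (N + N * n) (N + N * n)"
    using signed_laplacian_carrier[of "corona H G"] by (simp add: N_def n_def)
  have det_M: "det ?M = poly (char_poly (signed_laplacian G)) (t - 1)"
    using poly_char_poly[OF LG] by simp
  have rows: "(\<Sum>w<n. ?M $$ (v, w)) = ?r" if "v < n" for v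
  proof -
    have "(\<Sum>w<n. ?M $$ (v, w)) =
        (\<Sum>w<n. (if w = v then t - 1 else 0) - signed_laplacian G $$ (v, w))"
      using that LG by (intro sum.cong) auto
    also have "\<dots> = t - 1 - (\<Sum>w<n. signed_laplacian G $$ (v, w))"
      using that by (simp add: sum_subtractf)
    also have "\<dots> = ?r"
      using that signed_laplacian_row_sum[OF G, of v] d by (simp add: n_def)
    finally show ?thesis .
  qed
  have u: "?u i * ?u i = 1" for i
    using c1 marking_cases[of H i] by auto
  have "poly (char_poly (signed_laplacian (corona H G))) t =
      det (four_block_mat ?A (block_row N n ?u) (transpose_mat (block_row N n ?u))
        (block_diagonal N n ?M))"
    using characteristic_matrix_corona[OF H G c c1, of t] poly_char_poly[OF K, of t]
    by (simp add: N_def n_def)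
  also have "\<dots> = det (?A - (real n / ?r) \<cdot>\<^sub>m 1\<^sub>m N) * det ?M ^ N"
    using LH LG rows u t by (intro det_corona_block) (auto intro!: minus_carrier_mat)
  also have "?A - (real n / ?r) \<cdot>\<^sub>m 1\<^sub>m N =
      (t - real n - real n / ?r) \<cdot>\<^sub>m 1\<^sub>m N - signed_laplacian H"
    using LH by (intro eq_matI) auto
  also have "det \<dots> = poly (char_poly (signed_laplacian H)) (t - real n - real n / ?r)"
    using poly_char_poly[OF LH] by simp
  finally show ?thesis
    by (simp add: det_M)
qed

subsection \<open>Iterated spectra\<close>

text \<open>The values of \<open>f\<close> at \<open>x\<close> are the roots of this quadratic: they
  have sum \<open>b\<close> and product \<open>(b\<^sup>2 - r\<^sup>2) / 4\<close>, where the
  radicand is nonnegative and hence equals \<open>r\<^sup>2\<close>.\<close>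

lemma prod_mset_f_vals:
  "(\<Prod>y\<in>#f_vals n d x. t - y) = (t - real n - x) * (t - (2 * real d + 1)) - real n"
proof -
  define b where "b = 2 * real d + 1 + x + real n"
  define r where "r = sqrt (((2 * real d + 1) - (x + real n))\<^sup>2 + 4 * real n)"
  have "r\<^sup>2 = ((2 * real d + 1) - (x + real n))\<^sup>2 + 4 * real n"
    unfolding r_def by simp
  moreover have "(\<Prod>y\<in>#f_vals n d x. t - y) = (t - (b + r) / 2) * (t - (b - r) / 2)"
    by (simp add: f_vals_def b_def r_def Let_def)
  moreover have "(t - (b + r) / 2) * (t - (b - r) / 2) = t\<^sup>2 - b * t + (b\<^sup>2 - r\<^sup>2) / 4"
    by (simp add: field_simps power2_eq_square)
  ultimately show ?thesis
    by (simp add: b_def field_simps power2_eq_square)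
qed

text \<open>Each quadratic is the linear factor at the transformed argument times
  \<open>t - (2 * d + 1)\<close>, so clearing denominators costs one such factor per element of
  \<open>M\<close>.\<close>

lemma prod_mset_f_vals_sum:
  assumes "t \<noteq> 2 * real d + 1"
  shows "(\<Prod>y\<in>#(\<Sum>x\<in>#M. f_vals n d x). t - y) =
    (\<Prod>x\<in>#M. t - real n - real n / (t - (2 * real d + 1)) - x) *
    (t - (2 * real d + 1)) ^ size M"
proof (induction M)
  case (add x M)
  have "(t - real n - x) * (t - (2 * real d + 1)) - real n =
      (t - real n - real n / (t - (2 * real d + 1)) - x) * (t - (2 * real d + 1))"
    using assms by (simp add: left_diff_distrib)
  then show ?case
    using add by (simp add: prod_mset_f_vals)
qed simp

lemma prod_mset_replicate_sum:
  fixes M :: "'a :: comm_ring_1 multiset"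
  shows "(\<Prod>y\<in>#(\<Sum>x\<in>#M. replicate_mset k (x + 1)). t - y) = (\<Prod>x\<in>#M. t - (x + 1)) ^ k"
  by (induction M) (simp_all add: power_mult_distrib)

text \<open>\<open>E\<close> holds the eigenvalues of \<open>G\<close> other than one occurrence of
  \<open>2 * d\<close>. That occurrence contributes \<open>?r\<close> once per copy, and the number
  of copies is the size of \<open>\<Lambda>\<close>, so these factors are exactly those needed to
  form the quadratics.\<close>

lemma char_poly_corona:
  assumes H: "signed_graph H" and G: "signed_graph G"
    and c: "\<forall>w<num_nodes G. marking G w = c" "c = 1 \<or> c = -1"
    and d: "\<forall>w<num_nodes G. neg_degree G w = d"
    and spec_H: "char_poly (signed_laplacian H) = (\<Prod>x\<in>#\<Lambda>. [:- x, 1:])"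
    and spec_G: "char_poly (signed_laplacian G) = (\<Prod>x\<in>#add_mset (2 * real d) E. [:- x, 1:])"
  shows "char_poly (signed_laplacian (corona H G)) =
    (\<Prod>x\<in>#(\<Sum>x\<in>#\<Lambda>. f_vals (num_nodes G) d x) +
      (\<Sum>x\<in>#E. replicate_mset (num_nodes H) (x + 1)). [:- x, 1:])" (is "?P = ?Q")
proof (rule poly_eqI_except_point[where a = "2 * real d + 1"])
  fix t :: real assume t: "t \<noteq> 2 * real d + 1"
  let ?r = "t - (2 * real d + 1)"
  have size: "size \<Lambda> = num_nodes H"
    using degree_monic_char_poly[OF signed_laplacian_carrier, of H]
    by (simp add: spec_H degree_prod_linear_factors)
  have "poly ?P t = (\<Prod>x\<in>#\<Lambda>. t - real (num_nodes G) - real (num_nodes G) / ?r - x) *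
      (\<Prod>x\<in>#add_mset (2 * real d) E. t - 1 - x) ^ num_nodes H"
    unfolding poly_char_poly_corona[OF H G c d t] spec_H spec_G poly_prod_linear_factors ..
  also have "\<dots> = (\<Prod>x\<in>#\<Lambda>. t - real (num_nodes G) - real (num_nodes G) / ?r - x) * ?r ^ size \<Lambda> *
      (\<Prod>x\<in>#E. t - (x + 1)) ^ num_nodes H"
    by (simp add: size power_mult_distrib diff_diff_eq add.commute)
  also have "\<dots> = poly ?Q t"
    unfolding poly_prod_linear_factors unfolding image_mset_union prod_mset_Un
      prod_mset_f_vals_sum[OF t] prod_mset_replicate_sum ..
  finally show "poly ?P t = poly ?Q t" .
qed

text \<open>The claimed spectrum as a function of \<open>m\<close>, in a form suited to recursion.
  It is used for \<open>m \<ge> 1\<close> only; at \<open>m = 1\<close> the range of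
  \<open>i\<close> is empty, so the middle family disappears.\<close>

definition corona_spectrum :: "nat \<Rightarrow> nat \<Rightarrow> (nat \<Rightarrow> real) \<Rightarrow> nat \<Rightarrow> real multiset" where
  "corona_spectrum n d \<eta> m =
      (\<Sum>j = 1..n. f_iter n d m (\<eta> j))
    + (\<Sum>i = 1..m - 1. \<Sum>j = 1..n - 1.
         repeat_mset (n * (n + 1) ^ (m - i - 1)) (f_iter n d i (\<eta> j + 1)))
    + (\<Sum>j = 1..n - 1. replicate_mset (n * (n + 1) ^ (m - 1)) (\<eta> j + 1))"

lemma sum_mset_image_sum:
  fixes g :: "'b \<Rightarrow> 'a multiset" and f :: "'a \<Rightarrow> 'c :: comm_monoid_add"
  shows "(\<Sum>y\<in>#(\<Sum>j\<in>A. g j). f y) = (\<Sum>j\<in>A. \<Sum>y\<in>#g j. f y)"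
  by (induction A rule: infinite_finite_induct) auto

lemma sum_mset_image_repeat_mset:
  fixes f :: "'a \<Rightarrow> 'b multiset"
  shows "(\<Sum>y\<in>#repeat_mset k M. f y) = repeat_mset k (\<Sum>y\<in>#M. f y)"
  by (induction k) auto

text \<open>Applying \<open>f\<close> raises the iteration count by one in every family. In the
  middle family the exponent \<open>m - i - 1\<close> is unchanged when \<open>m\<close> and
  \<open>i\<close> both grow by one, and the former last family supplies the new terms with
  \<open>i = 1\<close>.\<close>

lemma corona_spectrum_Suc:
  "corona_spectrum n d \<eta> (Suc (Suc k)) =
    (\<Sum>x\<in>#corona_spectrum n d \<eta> (Suc k). f_vals n d x) +
    (\<Sum>j = 1..n - 1. replicate_mset (n * (n + 1) ^ Suc k) (\<eta> j + 1))"
proof -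
  let ?g = "\<lambda>i. \<Sum>j = 1..n - 1.
    repeat_mset (n * (n + 1) ^ (Suc (Suc k) - i - 1)) (f_iter n d i (\<eta> j + 1))"
  have "(\<Sum>x\<in>#(\<Sum>j = 1..n - 1. replicate_mset (n * (n + 1) ^ k) (\<eta> j + 1)). f_vals n d x) =
      (\<Sum>j = 1..n - 1. \<Sum>x\<in>#repeat_mset (n * (n + 1) ^ k) {#\<eta> j + 1#}. f_vals n d x)"
    by (simp add: sum_mset_image_sum del: sum_mset_replicate_mset)
  also have "\<dots> = ?g 1"
    unfolding sum_mset_image_repeat_mset by simp
  finally have last: "(\<Sum>x\<in>#(\<Sum>j = 1..n - 1. replicate_mset (n * (n + 1) ^ k) (\<eta> j + 1)).
      f_vals n d x) = ?g 1" .
  have "(\<Sum>i = 1..Suc k. ?g i) = ?g 1 + (\<Sum>i = 1..k. ?g (Suc i))"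
    using sum.atLeast_Suc_atMost[of 1 "Suc k" ?g] sum.shift_bounds_cl_Suc_ivl[of ?g 1 k]
    by (simp del: f_iter.simps)
  then show ?thesis
    using last by (simp add: corona_spectrum_def sum_mset_image_sum sum_mset_image_repeat_mset)
qed

section \<open>Spectrum of the iterated corona graphs\<close>

lemma signed_graph_corona_graph: "signed_graph G \<Longrightarrow> signed_graph (corona_graph G m)"
  by (induction m) (auto intro: signed_graph_corona)

lemma num_nodes_corona_graph: "num_nodes (corona_graph G m) = num_nodes G * (num_nodes G + 1) ^ m"
  by (induction m) (auto simp: algebra_simps)

theorem theorem7:
  fixes G :: sgraph and n d m :: nat and \<eta> :: "nat \<Rightarrow> real"
  assumes "signed_graph G"
    and "num_nodes G = n"
    and "\<forall>v<n. neg_degree G v = d"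
    and "(\<forall>v<n. marking G v = 1) \<or> (\<forall>v<n. marking G v = -1)"
    and "laplacian_eigenvalues G = {# \<eta> j. j \<in># mset_set {1..n} #}"
    and "\<eta> n = 2 * real d"
    and "m \<ge> 1"
  shows "laplacian_eigenvalues (corona_graph G m) =
      (\<Sum>j = 1..n. f_iter n d m (\<eta> j))
    + (\<Sum>i = 1..m - 1. \<Sum>j = 1..n - 1.
         repeat_mset (n * (n + 1) ^ (m - i - 1)) (f_iter n d i (\<eta> j + 1)))
    + (\<Sum>j = 1..n - 1. replicate_mset (n * (n + 1) ^ (m - 1)) (\<eta> j + 1))"
proof (cases "n = 0")
  \<comment> \<open>Without nodes, \<open>\<eta> n\<close> is not among the listed eigenvalues and
    nothing can be split off; both sides are then empty.\<close>
  case True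
  have "degree (char_poly (signed_laplacian (corona_graph G m))) = 0"
    using degree_monic_char_poly[OF signed_laplacian_carrier, of "corona_graph G m"]
      True assms(2) by (simp add: num_nodes_corona_graph)
  then have "laplacian_eigenvalues (corona_graph G m) = {#}"
    unfolding laplacian_eigenvalues_def
    using size_proots_le[of "char_poly (signed_laplacian (corona_graph G m))"] by simp
  then show ?thesis
    using True by simp
next
  case False
  obtain c where c: "\<forall>w<num_nodes G. marking G w = c" "c = 1 \<or> c = -1"
    using assms(2,4) by blast
  have d: "\<forall>w<num_nodes G. neg_degree G w = d"
    using assms(2,3) by blast
  let ?p = "char_poly (signed_laplacian G)"
  let ?E = "{# \<eta> j. j \<in># mset_set {1..n - 1} #}"
  have "{1..n} = insert n {1..n - 1}"
    using False by auto
  then have eigs: "{# \<eta> j. j \<in># mset_set {1..n} #} = add_mset (2 * real d) ?E"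
    using False assms(6) by simp
  \<comment> \<open>The assumed spectrum lists \<open>n\<close> roots, which is the degree of
    \<open>?p\<close>.\<close>
  have "?p = (\<Prod>x\<in>#proots ?p. [:- x, 1:])"
    using degree_monic_char_poly[OF signed_laplacian_carrier, of G] assms(2,5)
    by (intro prod_linear_factors_proots) (simp_all add: laplacian_eigenvalues_def)
  then have spec_G: "?p = (\<Prod>x\<in>#add_mset (2 * real d) ?E. [:- x, 1:])"
    using assms(5) eigs by (simp only: laplacian_eigenvalues_def)
  have "char_poly (signed_laplacian (corona_graph G (Suc k))) =
      (\<Prod>x\<in>#corona_spectrum n d \<eta> (Suc k). [:- x, 1:])" for k
  proof (induction k)
    \<comment> \<open>The first corona has \<open>G\<close> as both factors, so the full spectrum of
      \<open>G\<close> takes the place of \<open>\<Lambda>\<close>.\<close>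
    case 0
    have "corona_spectrum n d \<eta> (Suc 0) =
        (\<Sum>x\<in>#add_mset (2 * real d) ?E. f_vals (num_nodes G) d x) +
        (\<Sum>x\<in>#?E. replicate_mset (num_nodes G) (x + 1))"
      unfolding eigs[symmetric] corona_spectrum_def
      by (simp add: assms(2) sum_unfold_sum_mset image_mset.compositionality comp_def)
    with char_poly_corona[OF assms(1) assms(1) c d spec_G spec_G] show ?case
      by (simp only: corona_graph.simps)
  next
    case (Suc k)
    \<comment> \<open>The factor \<open>n * (n + 1) ^ Suc k\<close> is the number of nodes of the
      previous graph, hence the number of copies attached in this step.\<close>
    have "corona_spectrum n d \<eta> (Suc (Suc k)) =
        (\<Sum>x\<in>#corona_spectrum n d \<eta> (Suc k). f_vals (num_nodes G) d x) +
        (\<Sum>x\<in>#?E. replicate_mset (num_nodes (corona_graph G (Suc k))) (x + 1))"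
      unfolding corona_spectrum_Suc num_nodes_corona_graph
      by (simp add: assms(2) sum_unfold_sum_mset image_mset.compositionality comp_def)
    with char_poly_corona[OF signed_graph_corona_graph[OF assms(1)] assms(1) c d Suc.IH spec_G]
    show ?case
      by (simp only: corona_graph.simps)
  qed
  from this[of "m - 1"] have "laplacian_eigenvalues (corona_graph G m) = corona_spectrum n d \<eta> m"
    using assms(7) by (simp add: laplacian_eigenvalues_def proots_prod_linear_factors)
  then show ?thesis
    by (simp add: corona_spectrum_def)
qed

end
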